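(* Let $C^+(u,v)=\min\{u,v\}$ and $C^-(u,v)=\max\{u+v-1,0\}$ for $u,v\in[0,1]$. (1) If $h$ is a strictly convex distortion function, then $C^+$ is the unique copula that is universally optimal for $h$. (2) If $h$ is a strictly concave distortion function, then $C^-$ is the unique copula that is universally optimal for $h$.
   Context: Fix an atomless probability space $(\Omega,\mathcal A,\mathbb P)$ and let $\mathcal X$ be the set of bounded random variables on it. $X\overset{\mathrm d}{=}X'$ means equality in law. A distortion function is an increasing (non-strictly) function $h:[0,1]\to[0,1]$ with $h(0)=0$ and $h(1)=1$. The associated distorted expectation $\mathcal E^h:\mathcal X\to\mathbb R$ is $$\mathcal E^h[X]=\int_0^\infty h(\mathbb P(X>x))\,\mathrm dx+\int_{-\infty}^0\big(h(\mathbb P(X>x))-1\big)\,\mathrm dx.$$ A copula is a distribution function on $[0,1]^2$ with uniform $[0,1]$ marginals. $C$ is a copula of $(X,Y)$ if $\mathbb P(X\le x,Y\le y)=C(\mathbb P(X\le x),\mathbb P(Y\le y))$ for all $x,y\in\mathbb R$. A copula $C$ is universally optimal for $h$ (with linear cost $c(x,y)=x+y$) if for all $X,Y\in\mathcal X$ such that $C$ is a copula of $(X,Y)$, $\mathcal E^h[X+Y]\le\mathcal E^h[X'+Y']$ for all $X',Y'\in\mathcal X$ with $X'\overset{\mathrm d}{=}X$ and $Y'\overset{\mathrm d}{=}Y$. *)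

theory Defs
  imports "HOL-Probability.Probability"
begin

definition atomless :: "'a measure \<Rightarrow> bool" where
  "atomless M \<longleftrightarrow>
     (\<forall>A\<in>sets M. 0 < emeasure M A \<longrightarrow>
        (\<exists>B\<in>sets M. B \<subseteq> A \<and> 0 < emeasure M B \<and> emeasure M B < emeasure M A))"

definition bounded_rvs :: "'a measure \<Rightarrow> ('a \<Rightarrow> real) set" where
  "bounded_rvs M = {X \<in> borel_measurable M. \<exists>K. \<forall>\<omega>\<in>space M. \<bar>X \<omega>\<bar> \<le> K}"

definition eq_in_law :: "'a measure \<Rightarrow> ('a \<Rightarrow> real) \<Rightarrow> ('a \<Rightarrow> real) \<Rightarrow> bool" where
  "eq_in_law M X Y \<longleftrightarrow> distr M borel X = distr M borel Y"

text \<open>Functions on \<open>[0,1]\<close> and \<open>[0,1]\<^sup>2\<close> are total functions on \<open>real\<close>; only their values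
  on \<open>{0..1}\<close> are ever constrained or used.\<close>

definition distortion :: "(real \<Rightarrow> real) \<Rightarrow> bool" where
  "distortion h \<longleftrightarrow> h \<in> {0..1} \<rightarrow> {0..1} \<and> mono_on {0..1} h \<and> h 0 = 0 \<and> h 1 = 1"

definition strictly_convex_on :: "real set \<Rightarrow> (real \<Rightarrow> real) \<Rightarrow> bool" where
  "strictly_convex_on S f \<longleftrightarrow> convex S \<and>
     (\<forall>x\<in>S. \<forall>y\<in>S. \<forall>t. x \<noteq> y \<longrightarrow> 0 < t \<longrightarrow> t < 1 \<longrightarrow>
        f ((1 - t) * x + t * y) < (1 - t) * f x + t * f y)"

definition strictly_concave_on :: "real set \<Rightarrow> (real \<Rightarrow> real) \<Rightarrow> bool" where
  "strictly_concave_on S f \<longleftrightarrow> strictly_convex_on S (\<lambda>x. - f x)"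

definition distorted_expectation :: "'a measure \<Rightarrow> (real \<Rightarrow> real) \<Rightarrow> ('a \<Rightarrow> real) \<Rightarrow> real" where
  "distorted_expectation M h X =
     (LBINT x:{0..}. h (measure M {\<omega>\<in>space M. X \<omega> > x})) +
     (LBINT x:{..0}. (h (measure M {\<omega>\<in>space M. X \<omega> > x}) - 1))"

definition is_copula :: "(real \<Rightarrow> real \<Rightarrow> real) \<Rightarrow> bool" where
  "is_copula C \<longleftrightarrow>
     (\<exists>\<mu> :: (real \<times> real) measure. prob_space \<mu> \<and> sets \<mu> = sets borel \<and>
        distr \<mu> borel fst = uniform_measure lborel {0..1} \<and>
        distr \<mu> borel snd = uniform_measure lborel {0..1} \<and>
        (\<forall>u\<in>{0..1}. \<forall>v\<in>{0..1}. C u v = measure \<mu> ({..u} \<times> {..v})))"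

definition copula_of ::
  "'a measure \<Rightarrow> (real \<Rightarrow> real \<Rightarrow> real) \<Rightarrow> ('a \<Rightarrow> real) \<Rightarrow> ('a \<Rightarrow> real) \<Rightarrow> bool" where
  "copula_of M C X Y \<longleftrightarrow>
     (\<forall>x y. measure M {\<omega>\<in>space M. X \<omega> \<le> x \<and> Y \<omega> \<le> y} =
        C (measure M {\<omega>\<in>space M. X \<omega> \<le> x}) (measure M {\<omega>\<in>space M. Y \<omega> \<le> y}))"

definition universally_optimal ::
  "'a measure \<Rightarrow> (real \<Rightarrow> real) \<Rightarrow> (real \<Rightarrow> real \<Rightarrow> real) \<Rightarrow> bool" where
  "universally_optimal M h C \<longleftrightarrow>
     (\<forall>X\<in>bounded_rvs M. \<forall>Y\<in>bounded_rvs M. copula_of M C X Y \<longrightarrow>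
        (\<forall>X'\<in>bounded_rvs M. \<forall>Y'\<in>bounded_rvs M. eq_in_law M X' X \<longrightarrow> eq_in_law M Y' Y \<longrightarrow>
           distorted_expectation M h (\<lambda>\<omega>. X \<omega> + Y \<omega>)
             \<le> distorted_expectation M h (\<lambda>\<omega>. X' \<omega> + Y' \<omega>)))"

text \<open>Uniqueness is as a function on \<open>[0,1]\<^sup>2\<close>.\<close>

definition unique_universally_optimal_copula ::
  "'a measure \<Rightarrow> (real \<Rightarrow> real) \<Rightarrow> (real \<Rightarrow> real \<Rightarrow> real) \<Rightarrow> bool" where
  "unique_universally_optimal_copula M h C \<longleftrightarrow>
     is_copula C \<and> universally_optimal M h C \<and>
     (\<forall>D. is_copula D \<longrightarrow> universally_optimal M h D \<longrightarrow>
        (\<forall>u\<in>{0..1}. \<forall>v\<in>{0..1}. D u v = C u v))"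

definition C_plus :: "real \<Rightarrow> real \<Rightarrow> real" where
  "C_plus u v = min u v"

definition C_minus :: "real \<Rightarrow> real \<Rightarrow> real" where
  "C_minus u v = max (u + v - 1) 0"

end

theory Submission
  imports Defs
begin

text \<open>
  For bounded \<open>X\<close>, \<open>Y\<close> the expected excess \<open>E (X + Y - q)\<^sup>+\<close> equals
  \<open>\<integral> P(X > t, Y > q - t) dt\<close>, which for fixed marginals is increasing in the joint distribution
  function. Since \<open>E (Z - q)\<^sup>+\<close> is also the integral of the survival function of \<open>Z\<close> over
  \<open>{q..}\<close>, a pointwise larger joint distribution function makes \<open>X + Y\<close> larger in convex order.
  The integral of a convex function \<open>h\<close> of the survival function decreases in the convex order:
  this is clear for hinge functions \<open>max 0 (s - p)\<close>, hence holds for piecewise linear convex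
  functions by summation by parts, and in general by interpolation. As \<open>C_plus\<close> and \<open>C_minus\<close>
  are the Frechet bounds, applying this to \<open>h\<close> and to \<open>- h\<close> gives optimality.

  For uniqueness take two-valued \<open>X\<close>, \<open>Y\<close> vanishing on events of probabilities \<open>u\<close>, \<open>v\<close>
  whose intersection has probability \<open>w\<close>. Then the distorted expectation of \<open>X + Y\<close> is
  \<open>h (1 - w) + h (1 - u - v + w)\<close>, whose arguments have a fixed sum and a spread decreasing in
  \<open>w\<close>, so it is strictly monotone in \<open>w\<close>. An atomless space realises every admissible \<open>w\<close>.
\<close>

section \<open>Events of prescribed probability\<close>

text \<open>An event of positive probability has a subevent \<open>B\<close> of strictly smaller
  positive probability. The smaller of \<open>B\<close> and its relative complement has at most half
  the original probability, and iterating this halving goes below any \<open>e\<close>.\<close>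

lemma (in prob_space) atomless_small_subset:
  assumes "atomless M" "A \<in> events" "prob A > 0" "e > 0"
  obtains B where "B \<in> events" "B \<subseteq> A" "prob B > 0" "prob B < e"
proof -
  have half: "\<exists>B\<in>events. B \<subseteq> A \<and> 0 < prob B \<and> prob B \<le> prob A / 2"
    if A: "A \<in> events" "prob A > 0" for A
  proof -
    obtain B where B: "B \<in> events" "B \<subseteq> A" "0 < emeasure M B" "emeasure M B < emeasure M A"
      using assms(1) A unfolding atomless_def by (force simp: emeasure_eq_measure)
    then have lt: "0 < prob B" "prob B < prob A"
      by (auto simp: emeasure_eq_measure ennreal_less_iff)
    have "prob (A - B) = prob A - prob B"
      using A B by (simp add: finite_measure_Diff)
    then show ?thesis
      using lt A B by (cases "prob B \<le> prob A / 2") (blast, force intro: bexI[of _ "A - B"])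
  qed
  have "\<exists>B\<in>events. B \<subseteq> A \<and> 0 < prob B \<and> prob B \<le> (1/2)^n * prob A" for n
  proof (induction n)
    case 0
    then show ?case using assms by auto
  next
    case (Suc n)
    then obtain B where B: "B \<in> events" "B \<subseteq> A" "0 < prob B" "prob B \<le> (1/2)^n * prob A" by blast
    from half[OF B(1,3)] obtain B' where "B' \<in> events" "B' \<subseteq> B" "0 < prob B'" "prob B' \<le> prob B / 2" by blast
    with B show ?case by (intro bexI[of _ B']) auto
  qed
  moreover obtain n where "(1/2::real)^n < e" using real_arch_pow_inv[of e "1/2"] \<open>e > 0\<close> by auto
  moreover have "(1/2::real)^n * prob A \<le> (1/2)^n" for n by (simp add: mult_left_le)
  ultimately show ?thesis using that by (meson le_less_trans order_trans)
qed

lemma (in prob_space) atomless_subset_of_prob: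
  assumes at: "atomless M" and A: "A \<in> events" and c: "0 \<le> c" "c \<le> prob A"
  obtains B where "B \<in> events" "B \<subseteq> A" "prob B = c"
proof -
  \<comment> \<open>Greedy exhaustion: keep adding a disjoint piece of at least half the largest admissible size.\<close>
  define P where "P B = (B \<in> events \<and> B \<subseteq> A \<and> prob B \<le> c)" for B
  define S where "S B = prob ` {E. E \<in> events \<and> P (B \<union> E) \<and> B \<inter> E = {}}" for B
  have bdd: "bdd_above (S B)" for B
    unfolding S_def by (rule bdd_aboveI[of _ 1]) auto
  have step: "\<exists>B'. P B' \<and> B \<subseteq> B' \<and> prob (B' - B) \<ge> Sup (S B) / 2" if "P B" for B
  proof (cases "Sup (S B) > 0")
    case True
    have "prob {} \<in> S B" unfolding S_def using \<open>P B\<close> by (intro imageI) auto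
    then have "S B \<noteq> {}" by blast
    then obtain x where "x \<in> S B" "x > Sup (S B) / 2"
      using True less_cSup_iff[OF _ bdd, of B "Sup (S B) / 2"] by auto
    then obtain E where E: "E \<in> events" "P (B \<union> E)" "B \<inter> E = {}" "prob E > Sup (S B) / 2"
      by (auto simp: S_def)
    then have "B \<union> E - B = E" by auto
    with E show ?thesis by (intro exI[of _ "B \<union> E"]) auto
  next
    case False
    then show ?thesis using that by (intro exI[of _ B]) auto
  qed
  obtain f where f: "\<And>n. P (f n)" "\<And>n. f n \<subseteq> f (Suc n) \<and> prob (f (Suc n) - f n) \<ge> Sup (S (f n)) / 2"
    using dependent_nat_choice[of "\<lambda>_. P" "\<lambda>_ B B'. B \<subseteq> B' \<and> prob (B' - B) \<ge> Sup (S B) / 2"] step c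
    by (auto simp: P_def) (metis empty_iff measure_empty sets.empty_sets subsetI)
  have ev: "f n \<in> events" "f n \<subseteq> A" "prob (f n) \<le> c" for n using f(1)[of n] by (auto simp: P_def)
  have inc: "incseq f" using f(2) by (intro incseq_SucI) auto
  define B where "B = (\<Union>n. f n)"
  have BE: "B \<in> events" "B \<subseteq> A" using ev by (auto simp: B_def)
  have lim: "(\<lambda>n. prob (f n)) \<longlonglongrightarrow> prob B"
    unfolding B_def using ev inc by (intro finite_Lim_measure_incseq) auto
  then have le: "prob B \<le> c" using ev by (intro LIMSEQ_le_const2) auto
  have "prob B = c"
  proof (rule ccontr)
    assume "prob B \<noteq> c"
    with le have lt: "prob B < c" by simp
    have "prob (A - B) = prob A - prob B" using BE A by (simp add: finite_measure_Diff)
    then have "prob (A - B) > 0" using lt c by simp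
    \<comment> \<open>\<open>E\<close> is disjoint from every \<open>f n\<close> and small enough to
      fit under \<open>c\<close>, so it competes at every stage of the exhaustion. Each increment is
      then at least \<open>prob E / 2\<close>, whereas the increments of a convergent sequence tend
      to 0.\<close>
    then obtain E where E: "E \<in> events" "E \<subseteq> A - B" "prob E > 0" "prob E < c - prob B"
      using atomless_small_subset[OF at, of "A - B" "c - prob B"] BE A lt by auto
    have big: "prob (f (Suc n)) - prob (f n) \<ge> prob E / 2" for n
    proof -
      have d: "f n \<inter> E = {}" using E by (auto simp: B_def)
      have "prob (f n) \<le> prob B" using BE by (intro finite_measure_mono) (auto simp: B_def)
      then have "P (f n \<union> E)"
        using E ev[of n] d by (auto simp: P_def finite_measure_Union)
      then have "prob E \<in> S (f n)" using E d by (auto simp: S_def)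
      then have "prob E \<le> Sup (S (f n))" by (rule cSup_upper[OF _ bdd])
      also have "Sup (S (f n)) / 2 \<le> prob (f (Suc n) - f n)" using f(2) by blast
      also have "\<dots> = prob (f (Suc n)) - prob (f n)"
        using ev f(2) by (intro finite_measure_Diff) auto
      finally show ?thesis by simp
    qed
    have "(\<lambda>n. prob (f (Suc n)) - prob (f n)) \<longlonglongrightarrow> prob B - prob B"
      by (intro tendsto_intros lim LIMSEQ_Suc[OF lim])
    then have "prob E / 2 \<le> prob B - prob B"
      by (rule LIMSEQ_le_const) (use big in auto)
    with E show False by simp
  qed
  with BE that show ?thesis by blast
qed

text \<open>The second event is assembled from a part \<open>W\<close> of \<open>A\<close> with
  probability \<open>w\<close> and a part \<open>V\<close> of the complement with probability
  \<open>v - w\<close>. The Frechet bounds on \<open>w\<close> say that both parts fit: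
  \<open>w <= u\<close>, \<open>0 <= v - w\<close> and \<open>v - w <= 1 - u\<close>.\<close>

lemma (in prob_space) atomless_events_with_intersection:
  assumes at: "atomless M" and "u \<in> {0..1}" "v \<in> {0..1}" "max (u + v - 1) 0 \<le> w" "w \<le> min u v"
  obtains A B where "A \<in> events" "B \<in> events" "prob A = u" "prob B = v" "prob (A \<inter> B) = w"
proof -
  obtain A where A: "A \<in> events" "prob A = u"
    using atomless_subset_of_prob[OF at, of "space M" u] assms by (auto simp: prob_space)
  obtain W where W: "W \<in> events" "W \<subseteq> A" "prob W = w"
    using atomless_subset_of_prob[OF at, of A w] A assms by auto
  obtain V where V: "V \<in> events" "V \<subseteq> space M - A" "prob V = v - w"
    using atomless_subset_of_prob[OF at, of "space M - A" "v - w"] A assms by (auto simp: prob_compl)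
  have "prob (W \<union> V) = v"
    using W V by (subst finite_measure_Union) auto
  moreover have "A \<inter> (W \<union> V) = W" using W V by auto
  ultimately show ?thesis using that[of A "W \<union> V"] A W V by auto
qed

section \<open>Integrals of convex functions of survival functions\<close>

lemma antimono_borel_measurable:
  fixes F :: "real \<Rightarrow> real"
  assumes "antimono F"
  shows "F \<in> borel_measurable borel"
proof -
  have "mono (\<lambda>x. - F x)" using assms by (auto simp: monotone_def)
  then have "(\<lambda>x. - (- F x)) \<in> borel_measurable borel"
    by (intro borel_measurable_uminus borel_measurable_mono)
  then show ?thesis by simp
qed

lemma set_integrable_bounded_Icc:
  fixes f :: "real \<Rightarrow> real"
  assumes "f \<in> borel_measurable borel" "\<And>x. x \<in> {a..b} \<Longrightarrow> \<bar>f x\<bar> \<le> B"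
  shows "set_integrable lborel {a..b} f"
  unfolding set_integrable_def
  by (rule integrableI_bounded_set_indicator[where B = B]) (use assms in \<open>auto simp: emeasure_lborel_Icc_eq\<close>)

text \<open>\<open>G\<close> exceeds \<open>p\<close> on an initial interval, on which \<open>G - p\<close> may be compared with \<open>F - p\<close>.\<close>

lemma integral_excess_mono:
  fixes F G :: "real \<Rightarrow> real"
  assumes F: "antimono F" "\<And>x. F x \<in> {0..1}" and G: "antimono G" "\<And>x. G x \<in> {0..1}"
    and H: "\<And>q. q \<in> {a..b} \<Longrightarrow> (LBINT x:{a..q}. G x) \<le> (LBINT x:{a..q}. F x)"
  shows "(LBINT x:{a..b}. max 0 (G x - p)) \<le> (LBINT x:{a..b}. max 0 (F x - p))"
proof -
  note [measurable] = antimono_borel_measurable[OF F(1)] antimono_borel_measurable[OF G(1)]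
  have bd: "\<bar>F x\<bar> \<le> 1" "\<bar>G x\<bar> \<le> 1" for x using F(2)[of x] G(2)[of x] by auto
  have int: "set_integrable lborel {a..c} F" "set_integrable lborel {a..c} G"
      "set_integrable lborel {a..c} (\<lambda>x. p)" for c
    by (auto intro: set_integrable_bounded_Icc[OF _ bd(1)] set_integrable_bounded_Icc[OF _ bd(2)]
        set_integrable_bounded_Icc)
  have intmax: "set_integrable lborel {a..b} (\<lambda>x. max 0 (F x - p))"
  proof (rule set_integrable_bounded_Icc[where B = "1 + \<bar>p\<bar>"])
    show "\<bar>max 0 (F x - p)\<bar> \<le> 1 + \<bar>p\<bar>" for x using bd(1)[of x] by linarith
  qed auto
  define S where "S = {x \<in> {a..b}. G x > p}"
  show ?thesis
  proof (cases "S = {}")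
    case True
    then have "(LBINT x:{a..b}. max 0 (G x - p)) = (LBINT x:{a..b}. 0)"
      by (intro set_lebesgue_integral_cong) (auto simp: S_def not_less max_def)
    also have "\<dots> = 0" by simp
    also have "0 \<le> (LBINT x:{a..b}. max 0 (F x - p))"
      unfolding set_lebesgue_integral_def by (intro Bochner_Integration.integral_nonneg) auto
    finally show ?thesis .
  next
    case False
    have bdd: "bdd_above S" unfolding S_def by (intro bdd_aboveI[of _ b]) auto
    define q where "q = Sup S"
    have q: "q \<in> {a..b}"
      using False cSup_least[OF False, of b] bdd cSup_upper2[OF _ _ bdd, of _ a] unfolding q_def S_def by auto
    have below: "G x > p" if "x \<in> {a..b}" "x < q" for x
    proof -
      have "x < Sup S" using that by (simp add: q_def)
      then obtain y where "y \<in> S" "x < y"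
        using less_cSup_iff[OF False bdd] by blast
      then show ?thesis using antimonoD[OF G(1), of x y] by (auto simp: S_def)
    qed
    have above: "G x \<le> p" if "x \<in> {a..b}" "q < x" for x
      using that cSup_upper[OF _ bdd, of x] unfolding q_def by (force simp: S_def)
    have "(LBINT x:{a..b}. max 0 (G x - p)) = (LBINT x:{a..q}. G x - p)"
      unfolding set_lebesgue_integral_def
    proof (intro integral_cong_AE)
      \<comment> \<open>At \<open>q\<close> itself \<open>G\<close> may lie on either side of
        \<open>p\<close>, since no continuity is assumed, so the integrands are compared only away
        from this null point.\<close>
      have "AE x in lborel. x \<noteq> q" by (rule AE_lborel_singleton)
      then show "AE x in lborel. indicat_real {a..b} x *\<^sub>R max 0 (G x - p) = indicat_real {a..q} x *\<^sub>R (G x - p)"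
      proof eventually_elim
        case (elim x)
        then show ?case using below[of x] above[of x] q by (cases "x < q") (auto simp: indicator_def max_def)
      qed
    qed auto
    also have "\<dots> = (LBINT x:{a..q}. G x) - (LBINT x:{a..q}. p)"
      by (intro set_integral_diff int)
    also have "\<dots> \<le> (LBINT x:{a..q}. F x) - (LBINT x:{a..q}. p)" using H[OF q] by simp
    also have "\<dots> = (LBINT x:{a..q}. F x - p)"
      by (intro set_integral_diff(2)[symmetric] int)
    \<comment> \<open>Two enlargements: the positive part replaces \<open>F x - p\<close> on
      \<open>{a..q}\<close>, and the nonnegative contribution beyond \<open>q\<close> is
      added.\<close>
    also have "\<dots> \<le> (LBINT x:{a..b}. max 0 (F x - p))"
      unfolding set_lebesgue_integral_def
      using intmax set_integral_diff(1)[OF int(1)[of q] int(3)[of q]] q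
      by (intro integral_mono) (auto simp: set_integrable_def indicator_def)
    finally show ?thesis .
  qed
qed

text \<open>Abel summation turns the sum into that of \<open>(d k - d (k - 1)) * J k\<close> over
  the inner indices, as \<open>J\<close> vanishes at both ends. In the application \<open>d\<close>
  lists the slopes of an interpolated convex function and \<open>J\<close> the differences of
  excesses.\<close>

lemma summation_by_parts_nonneg:
  fixes d J :: "nat \<Rightarrow> real"
  assumes d: "\<And>k. Suc k < n \<Longrightarrow> d k \<le> d (Suc k)"
    and J: "\<And>k. 0 \<le> J k" "J 0 = 0" "J n = 0"
  shows "0 \<le> (\<Sum>k<n. d k * (J k - J (Suc k)))"
proof (cases n)
  case (Suc m)
  \<comment> \<open>The left side is the boundary term of the Abel summation. It is kept for the
    induction and vanishes at the last index because \<open>J n = 0\<close>.\<close>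
  have "- d i * J (Suc i) \<le> (\<Sum>k<Suc i. d k * (J k - J (Suc k)))" if "i < n" for i
    using that
  proof (induction i)
    case 0
    then show ?case using J by simp
  next
    case (Suc i)
    have "d i * J (Suc i) \<le> d (Suc i) * J (Suc i)"
      using Suc.prems d J(1) by (intro mult_right_mono) auto
    then show ?case using Suc.IH Suc.prems by (simp add: algebra_simps)
  qed
  from this[of m] show ?thesis using Suc J by simp
qed simp

text \<open>Piecewise linear interpolation of \<open>h\<close> on the grid \<open>k / N\<close>, written in hinge functions
  \<open>max 0 (s - k / N)\<close> so that its integral along \<open>F\<close> only involves the excesses of \<open>F\<close>.\<close>

definition chord_interp :: "(real \<Rightarrow> real) \<Rightarrow> nat \<Rightarrow> real \<Rightarrow> real" where
  "chord_interp h N s = h 0 + (\<Sum>k<N. real N * (h (Suc k / N) - h (k / N)) *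
     (max 0 (s - k / N) - max 0 (s - Suc k / N)))"

text \<open>The difference of consecutive hinges is \<open>1 / N\<close> for cells to the left of
  \<open>s\<close> and 0 for cells to the right, so the sum telescopes up to the cell of
  \<open>s\<close>, which contributes the linear term. Cells are closed on both sides, so a grid
  point may be treated as an end of either neighbouring cell.\<close>

lemma chord_interp_eq:
  fixes s :: real
  assumes j: "j < N" "real j \<le> N * s" "N * s \<le> Suc j"
  shows "chord_interp h N s = h (j / N) + (N * s - j) * (h (Suc j / N) - h (j / N))"
proof -
  have N: "real N > 0" using j by simp
  define f where "f k = real N * (h (Suc k / N) - h (k / N)) *
     (max 0 (s - k / N) - max 0 (s - Suc k / N))" for k :: nat
  have "(\<Sum>k<N. f k) = (\<Sum>k<Suc j. f k)"
  proof (rule sum.mono_neutral_right)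
    show "\<forall>i\<in>{..<N} - {..<Suc j}. f i = 0"
    proof
      fix i assume "i \<in> {..<N} - {..<Suc j}"
      then have "real (Suc j) \<le> real i" by auto
      then have "N * s \<le> real i" using j by linarith
      then have "s \<le> real i / N" "s \<le> real (Suc i) / N"
        using N by (auto simp: field_simps)
      then show "f i = 0" by (simp add: f_def max_def)
    qed
  qed (use j in auto)
  also have "\<dots> = (\<Sum>k<j. f k) + f j" by simp
  also have "(\<Sum>k<j. f k) = (\<Sum>k<j. h (Suc k / N) - h (k / N))"
  proof (intro sum.cong refl)
    fix i assume "i \<in> {..<j}"
    then have "real (Suc i) \<le> real j" by auto
    then have "real (Suc i) \<le> N * s" using j by linarith
    then have "real (Suc i) / N \<le> s" "real i / N \<le> s" using N by (auto simp: field_simps)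
    then have "max 0 (s - i / N) - max 0 (s - Suc i / N) = 1 / N"
      using N by (auto simp: field_simps)
    then show "f i = h (Suc i / N) - h (i / N)" using N by (simp add: f_def)
  qed
  also have "\<dots> = h (j / N) - h 0" by (subst sum_lessThan_telescope) auto
  also have "f j = (N * s - j) * (h (Suc j / N) - h (j / N))"
  proof -
    have "s \<ge> j / N" "s \<le> Suc j / N" using j N by (auto simp: field_simps)
    then have "max 0 (s - j / N) - max 0 (s - Suc j / N) = (N * s - j) / N"
      using N by (auto simp: field_simps)
    then show ?thesis using N by (simp add: f_def)
  qed
  finally show ?thesis by (simp add: chord_interp_def f_def)
qed

lemma chord_interp_cell:
  fixes s :: real
  assumes s: "s \<in> {0..1}" and N: "N > 0"
  obtains j :: nat where "j < N" "real j \<le> N * s" "N * s \<le> Suc j"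
\<comment> \<open>At \<open>s = 1\<close> the floor would give the index \<open>N\<close>, beyond
  the grid; the last cell is used instead.\<close>
proof (cases "s = 1")
  case True
  with that[of "N - 1"] N show ?thesis by (auto simp: of_nat_diff)
next
  case False
  define j where "j = nat \<lfloor>N * s\<rfloor>"
  have "N * s < N" using False s N by simp
  moreover have "real j \<le> N * s" "N * s \<le> Suc j" using s of_nat_floor[of "N * s"] real_of_int_floor_add_one_ge[of "N * s"]
    by (auto simp: j_def add.commute)
  ultimately show ?thesis using that[of j] by auto
qed

text \<open>On each cell the interpolation is a convex combination of two values of
  \<open>h\<close>. The bound is uniform in \<open>N\<close> and serves as the dominating constant
  for the passage to the limit.\<close>

lemma chord_interp_bounded:
  assumes B: "\<And>s. s \<in> {0..1} \<Longrightarrow> \<bar>h s\<bar> \<le> B" and s: "s \<in> {0..1}" and N: "N > 0"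
  shows "\<bar>chord_interp h N s\<bar> \<le> B"
proof -
  obtain j where j: "j < N" "real j \<le> N * s" "N * s \<le> Suc j" using chord_interp_cell[OF s N] .
  define t where "t = N * s - j"
  have t: "0 \<le> t" "t \<le> 1" using j by (auto simp: t_def)
  have e: "chord_interp h N s = (1 - t) * h (j / N) + t * h (Suc j / N)"
    unfolding chord_interp_eq[OF j] t_def by (simp add: algebra_simps)
  have "\<bar>h (j / N)\<bar> \<le> B" "\<bar>h (Suc j / N)\<bar> \<le> B" using j by (auto intro!: B)
  then have "\<bar>(1 - t) * h (j / N)\<bar> + \<bar>t * h (Suc j / N)\<bar> \<le> (1 - t) * B + t * B"
    using t unfolding abs_mult by (intro add_mono mult_mono) auto
  then show ?thesis unfolding e by (simp add: algebra_simps)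
qed

text \<open>A convex function on \<open>{0..1}\<close> is continuous in the interior but may jump at
  the ends. There the interpolation is exact, so continuity is needed only for
  \<open>0 < s < 1\<close>.\<close>

lemma chord_interp_tendsto:
  assumes h: "convex_on {0..1} h" and s: "s \<in> {0..1}"
  shows "(\<lambda>n. chord_interp h (Suc n) s) \<longlonglongrightarrow> h s"
proof -
  consider "s = 0" | "s = 1" | "0 < s" "s < 1" using s by force
  then show ?thesis
  proof cases
    case 1
    then have "chord_interp h (Suc n) s = h s" for n
      by (subst chord_interp_eq[of 0]) auto
    then show ?thesis by simp
  next
    case 2
    then have "chord_interp h (Suc n) s = h s" for n
      by (subst chord_interp_eq[of n]) auto
    then show ?thesis by simp
  next
    case 3
    define j where "j n = nat \<lfloor>Suc n * s\<rfloor>" for n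
    have j: "j n < Suc n" "real (j n) \<le> Suc n * s" "Suc n * s \<le> Suc (j n)" for n
    proof -
      show *: "real (j n) \<le> Suc n * s" "Suc n * s \<le> Suc (j n)" using 3 of_nat_floor[of "Suc n * s"] real_of_int_floor_add_one_ge[of "Suc n * s"]
        by (auto simp: j_def add.commute)
      have "real (Suc n) * s < real (Suc n) * 1" using 3 by (intro mult_strict_left_mono) auto
      from le_less_trans[OF *(1) this] show "j n < Suc n" by simp
    qed
    have "isCont h s"
    proof -
      have "convex_on {0<..<1} h" by (rule convex_on_subset[OF h]) auto
      then have "continuous_on {0<..<1} h" by (intro convex_on_continuous) auto
      then show ?thesis using 3 by (simp add: continuous_on_eq_continuous_at)
    qed
    have inv: "(\<lambda>n. 1 / real (Suc n)) \<longlonglongrightarrow> 0"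
      using LIMSEQ_inverse_real_of_nat by (simp add: inverse_eq_divide)
    have l1: "(\<lambda>n. j n / Suc n) \<longlonglongrightarrow> s"
    proof (rule tendsto_sandwich)
      show "\<forall>\<^sub>F n in sequentially. s - 1 / Suc n \<le> j n / Suc n"
      proof (intro always_eventually allI)
        fix n
        have "s - 1 / Suc n = (Suc n * s - 1) / Suc n" by (simp add: field_simps)
        also have "\<dots> \<le> j n / Suc n" using j(3)[of n] by (intro divide_right_mono) auto
        finally show "s - 1 / Suc n \<le> j n / Suc n" .
      qed
      show "\<forall>\<^sub>F n in sequentially. j n / Suc n \<le> s"
        using j(2) by (auto simp: field_simps)
      show "(\<lambda>n. s - 1 / real (Suc n)) \<longlonglongrightarrow> s" using tendsto_diff[OF tendsto_const inv, of s] by simp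
    qed auto
    have l2: "(\<lambda>n. Suc (j n) / Suc n) \<longlonglongrightarrow> s"
      using tendsto_add[OF l1 inv] by (simp add: add_divide_distrib add.commute)
    have h1: "(\<lambda>n. h (j n / Suc n)) \<longlonglongrightarrow> h s" and h2: "(\<lambda>n. h (Suc (j n) / Suc n)) \<longlonglongrightarrow> h s"
      using isCont_tendsto_compose[OF \<open>isCont h s\<close>] l1 l2 by blast+
    \<comment> \<open>The weight stays in \<open>{0..1}\<close>, and the values of \<open>h\<close>
      at the two ends of the cell have the same limit.\<close>
    have "(\<lambda>n. (Suc n * s - j n) * (h (Suc (j n) / Suc n) - h (j n / Suc n))) \<longlonglongrightarrow> 0"
    proof (rule Lim_null_comparison)
      show "(\<lambda>n. \<bar>h (Suc (j n) / Suc n) - h (j n / Suc n)\<bar>) \<longlonglongrightarrow> 0"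
        using tendsto_rabs[OF tendsto_diff[OF h2 h1]] by simp
      show "\<forall>\<^sub>F n in sequentially. norm ((Suc n * s - j n) * (h (Suc (j n) / Suc n) - h (j n / Suc n)))
          \<le> \<bar>h (Suc (j n) / Suc n) - h (j n / Suc n)\<bar>"
      proof (intro always_eventually allI)
        fix n
        have "\<bar>Suc n * s - j n\<bar> \<le> 1" using j(2,3)[of n] by auto
        then show "norm ((Suc n * s - j n) * (h (Suc (j n) / Suc n) - h (j n / Suc n)))
            \<le> \<bar>h (Suc (j n) / Suc n) - h (j n / Suc n)\<bar>"
          unfolding real_norm_def abs_mult by (intro mult_left_le_one_le) auto
      qed
    qed
    from tendsto_add[OF h1 this] show ?thesis
      by (subst chord_interp_eq[OF j]) simp
  qed
qed

text \<open>This is the Hardy-Littlewood-Polya inequality for decreasing functions: \<open>G\<close>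
  is majorized by \<open>F\<close> in the integral sense. By \<open>integral_excess_mono\<close> the
  excesses of \<open>F\<close> over every level dominate those of \<open>G\<close>, and the
  interpolations of \<open>h\<close> combine these excesses with increasing slopes.\<close>

lemma convex_integral_mono:
  fixes F G :: "real \<Rightarrow> real"
  assumes F: "antimono F" "\<And>x. F x \<in> {0..1}" and G: "antimono G" "\<And>x. G x \<in> {0..1}"
    and le: "\<And>q. q \<in> {a..b} \<Longrightarrow> (LBINT x:{a..q}. G x) \<le> (LBINT x:{a..q}. F x)"
    and eq: "(LBINT x:{a..b}. G x) = (LBINT x:{a..b}. F x)"
    and h: "convex_on {0..1} h" "\<And>s. s \<in> {0..1} \<Longrightarrow> \<bar>h s\<bar> \<le> B"
  shows "(LBINT x:{a..b}. h (G x)) \<le> (LBINT x:{a..b}. h (F x))"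
proof -
  have lim: "(\<lambda>n. LBINT x:{a..b}. chord_interp h (Suc n) (F x)) \<longlonglongrightarrow> (LBINT x:{a..b}. h (F x))"
    if F: "antimono F" "\<And>x. F x \<in> {0..1}" for F :: "real \<Rightarrow> real"
  proof -
    have [measurable]: "F \<in> borel_measurable borel" by (rule antimono_borel_measurable[OF F(1)])
    have m: "(\<lambda>x. chord_interp h n (F x)) \<in> borel_measurable borel" for n
      unfolding chord_interp_def by measurable
    \<comment> \<open>Nothing is known about \<open>h\<close> outside \<open>{0..1}\<close>, so
      measurability is obtained for the composition, as a pointwise limit of interpolations.\<close>
    have [measurable]: "(\<lambda>x. h (F x)) \<in> borel_measurable borel"
      by (rule borel_measurable_LIMSEQ_real[where u = "\<lambda>n x. chord_interp h (Suc n) (F x)"]) (use chord_interp_tendsto[OF h(1)] F m in auto)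
    show ?thesis
      unfolding set_lebesgue_integral_def
    proof (rule integral_dominated_convergence[where w = "\<lambda>x. indicat_real {a..b} x * B"])
      show "integrable lborel (\<lambda>x. indicat_real {a..b} x * B)"
        using set_integrable_bounded_Icc[of "\<lambda>_. B" a b "\<bar>B\<bar>"] by (simp add: set_integrable_def)
    qed (use m chord_interp_tendsto[OF h(1)] chord_interp_bounded[OF h(2)] F in
          \<open>auto intro!: tendsto_intros simp: indicator_def abs_mult\<close>)
  qed
  define A where "A F p = (LBINT x:{a..b}. max 0 (F x - p))" for F :: "real \<Rightarrow> real" and p
  have expand: "(LBINT x:{a..b}. chord_interp h N (F x)) =
      (LBINT x:{a..b}. h 0) + (\<Sum>k<N. real N * (h (Suc k / N) - h (k / N)) * (A F (k / N) - A F (Suc k / N)))"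
    if F: "antimono F" "\<And>x. F x \<in> {0..1}" for F :: "real \<Rightarrow> real" and N
  proof -
    have [measurable]: "F \<in> borel_measurable borel" by (rule antimono_borel_measurable[OF F(1)])
    have i: "set_integrable lborel {a..b} (\<lambda>x. max 0 (F x - p))" for p
    proof (rule set_integrable_bounded_Icc[where B = "1 + \<bar>p\<bar>"])
      show "\<bar>max 0 (F x - p)\<bar> \<le> 1 + \<bar>p\<bar>" for x using F(2)[of x] by (auto simp: max_def)
    qed auto
    have c: "set_integrable lborel {a..b} (\<lambda>x. h 0)"
      by (rule set_integrable_bounded_Icc) auto
    have t: "set_integrable lborel {a..b} (\<lambda>x. real N * (h (Suc k / N) - h (k / N)) *
        (max 0 (F x - k / N) - max 0 (F x - Suc k / N)))" for k
      by (intro set_integrable_mult_right set_integral_diff i)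
    have s: "set_integrable lborel {a..b} (\<lambda>x. \<Sum>k<N. real N * (h (Suc k / N) - h (k / N)) *
        (max 0 (F x - k / N) - max 0 (F x - Suc k / N)))"
      using t unfolding set_integrable_def scaleR_sum_right by (intro Bochner_Integration.integrable_sum) auto
    have "(LBINT x:{a..b}. \<Sum>k<N. real N * (h (Suc k / N) - h (k / N)) *
        (max 0 (F x - k / N) - max 0 (F x - Suc k / N))) =
        (\<Sum>k<N. LBINT x:{a..b}. real N * (h (Suc k / N) - h (k / N)) *
        (max 0 (F x - k / N) - max 0 (F x - Suc k / N)))"
      using t unfolding set_integrable_def set_lebesgue_integral_def scaleR_sum_right
      by (intro Bochner_Integration.integral_sum) auto
    also have "\<dots> = (\<Sum>k<N. real N * (h (Suc k / N) - h (k / N)) * (A F (k / N) - A F (Suc k / N)))"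
      by (simp add: set_integral_diff(2)[OF i i] A_def del: of_nat_Suc)
    finally show ?thesis
      unfolding chord_interp_def by (subst set_integral_add(2)[OF c s]) simp
  qed
  have "(LBINT x:{a..b}. chord_interp h N (G x)) \<le> (LBINT x:{a..b}. chord_interp h N (F x))" if N: "N > 0" for N
  proof -
    define J where "J k = A F (real k / N) - A G (real k / N)" for k :: nat
    have "0 \<le> (\<Sum>k<N. (N * (h (Suc k / N) - h (k / N))) * (J k - J (Suc k)))"
    proof (rule summation_by_parts_nonneg)
      fix k assume k: "Suc k < N"
      have "h ((1 - 1/2) *\<^sub>R (real k / N) + (1/2) *\<^sub>R (real (Suc (Suc k)) / N))
          \<le> (1 - 1/2) * h (k / N) + 1/2 * h (Suc (Suc k) / N)"
        using k by (intro convex_onD[OF h(1)]) auto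
      also have "(1 - 1/2) *\<^sub>R (real k / N) + (1/2) *\<^sub>R (real (Suc (Suc k)) / N) = Suc k / N"
        using N by (simp add: field_simps)
      finally show "real N * (h (Suc k / N) - h (k / N)) \<le> real N * (h (Suc (Suc k) / N) - h (Suc k / N))"
        by (intro mult_left_mono) auto
    next
      show "0 \<le> J k" for k
        unfolding J_def A_def using integral_excess_mono[OF F G le] by simp
      \<comment> \<open>At level 0 the excess is the function itself, so \<open>J 0 = 0\<close> is
        the equality of the totals. At level 1 there is no excess, since the values are at most
        1.\<close>
      have "max 0 (F x) = F x" "max 0 (G x) = G x" for x using F(2)[of x] G(2)[of x] by auto
      then show "J 0 = 0" using eq by (simp add: J_def A_def)
      have "max 0 (F x - 1) = 0" "max 0 (G x - 1) = 0" for x using F(2)[of x] G(2)[of x] by auto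
      then show "J N = 0" using N by (simp add: J_def A_def)
    qed
    also have "\<dots> = (\<Sum>k<N. real N * (h (Suc k / N) - h (k / N)) * (A F (k / N) - A F (Suc k / N)))
        - (\<Sum>k<N. real N * (h (Suc k / N) - h (k / N)) * (A G (k / N) - A G (Suc k / N)))"
      by (subst sum_subtractf[symmetric]) (simp add: J_def algebra_simps)
    finally show ?thesis using expand[OF F] expand[OF G] by simp
  qed
  then show ?thesis by (intro LIMSEQ_le[OF lim[OF G] lim[OF F]]) auto
qed

section \<open>Sums with ordered joint distribution functions\<close>

definition survival :: "'a measure \<Rightarrow> ('a \<Rightarrow> real) \<Rightarrow> real \<Rightarrow> real" where
  "survival M Z x = measure M {\<omega> \<in> space M. Z \<omega> > x}"

context prob_space begin

lemma survival_mem: "survival M Z x \<in> {0..1}"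
  by (simp add: survival_def)

lemma antimono_survival:
  assumes "Z \<in> borel_measurable M"
  shows "antimono (survival M Z)"
  using assms unfolding survival_def by (intro antimonoI finite_measure_mono) auto

text \<open>The excess is the length of the interval \<open>{q - Y \<omega><..<X \<omega>}\<close>, then Fubini.\<close>

lemma nn_integral_excess_sum:
  assumes [measurable]: "X \<in> borel_measurable M" "Y \<in> borel_measurable M"
  shows "(\<integral>\<^sup>+\<omega>. ennreal (max 0 (X \<omega> + Y \<omega> - q)) \<partial>M) =
    (\<integral>\<^sup>+t. emeasure M {\<omega> \<in> space M. X \<omega> > t \<and> Y \<omega> > q - t} \<partial>lborel)"
proof -
  interpret pair_sigma_finite M lborel ..
  have "(\<integral>\<^sup>+\<omega>. ennreal (max 0 (X \<omega> + Y \<omega> - q)) \<partial>M) =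
      (\<integral>\<^sup>+\<omega>. (\<integral>\<^sup>+t. (if X \<omega> > t \<and> Y \<omega> > q - t then 1 else 0) \<partial>lborel) \<partial>M)"
  proof (intro nn_integral_cong)
    fix \<omega>
    have "{t. X \<omega> > t \<and> Y \<omega> > q - t} = {q - Y \<omega><..<X \<omega>}" by auto
    moreover have "emeasure lborel {q - Y \<omega><..<X \<omega>} = ennreal (max 0 (X \<omega> + Y \<omega> - q))"
      by (cases "q - Y \<omega> \<le> X \<omega>") (auto simp: algebra_simps max_def)
    moreover have "(\<integral>\<^sup>+t. (if X \<omega> > t \<and> Y \<omega> > q - t then 1 else 0) \<partial>lborel) =
        (\<integral>\<^sup>+t. indicator {t. X \<omega> > t \<and> Y \<omega> > q - t} t \<partial>lborel)"
      by (intro nn_integral_cong) (auto simp: indicator_def)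
    ultimately show "ennreal (max 0 (X \<omega> + Y \<omega> - q)) =
        (\<integral>\<^sup>+t. (if X \<omega> > t \<and> Y \<omega> > q - t then 1 else 0) \<partial>lborel)"
      by simp
  qed
  also have "\<dots> = (\<integral>\<^sup>+t. (\<integral>\<^sup>+\<omega>. (if X \<omega> > t \<and> Y \<omega> > q - t then 1 else 0) \<partial>M) \<partial>lborel)"
    by (rule Fubini'[symmetric]) measurable
  also have "\<dots> = (\<integral>\<^sup>+t. emeasure M {\<omega> \<in> space M. X \<omega> > t \<and> Y \<omega> > q - t} \<partial>lborel)"
  proof (intro nn_integral_cong)
    fix t
    have "(\<integral>\<^sup>+\<omega>. (if X \<omega> > t \<and> Y \<omega> > q - t then 1 else 0) \<partial>M) =
        (\<integral>\<^sup>+\<omega>. indicator {\<omega> \<in> space M. X \<omega> > t \<and> Y \<omega> > q - t} \<omega> \<partial>M)"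
      by (intro nn_integral_cong) (auto simp: indicator_def)
    then show "(\<integral>\<^sup>+\<omega>. (if X \<omega> > t \<and> Y \<omega> > q - t then 1 else 0) \<partial>M) =
        emeasure M {\<omega> \<in> space M. X \<omega> > t \<and> Y \<omega> > q - t}" by simp
  qed
  finally show ?thesis .
qed

lemma integrable_bounded:
  fixes Z :: "'a \<Rightarrow> real"
  assumes "Z \<in> borel_measurable M" "\<And>\<omega>. \<omega> \<in> space M \<Longrightarrow> \<bar>Z \<omega>\<bar> \<le> K"
  shows "integrable M Z"
  by (rule integrable_const_bound[where B = K]) (use assms in auto)

text \<open>The case \<open>Y = 0\<close> of \<open>nn_integral_excess_sum\<close>: the condition
  \<open>0 > q - t\<close> cuts the integral off below \<open>q\<close>, and the bound on
  \<open>Z\<close> cuts it off above \<open>K\<close>.\<close>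

lemma integral_survival:
  assumes Z: "Z \<in> borel_measurable M" "\<And>\<omega>. \<omega> \<in> space M \<Longrightarrow> \<bar>Z \<omega>\<bar> \<le> K"
  shows "(LBINT t:{q..K}. survival M Z t) = expectation (\<lambda>\<omega>. max 0 (Z \<omega> - q))"
proof -
  note [measurable] = Z(1) antimono_borel_measurable[OF antimono_survival[OF Z(1)]]
  have "ennreal (expectation (\<lambda>\<omega>. max 0 (Z \<omega> - q))) = (\<integral>\<^sup>+\<omega>. ennreal (max 0 (Z \<omega> + 0 - q)) \<partial>M)"
  proof (subst nn_integral_eq_integral)
    show "integrable M (\<lambda>\<omega>. max 0 (Z \<omega> + 0 - q))"
      by (rule integrable_bounded[where K = "K + \<bar>q\<bar>"]) (use Z(2) in \<open>force simp: max_def abs_le_iff\<close>)+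
  qed auto
  also have "\<dots> = (\<integral>\<^sup>+t. emeasure M {\<omega> \<in> space M. Z \<omega> > t \<and> 0 > q - t} \<partial>lborel)"
    by (rule nn_integral_excess_sum) auto
  also have "\<dots> = (\<integral>\<^sup>+t. ennreal (indicator {q..K} t *\<^sub>R survival M Z t) \<partial>lborel)"
  proof (rule nn_integral_cong_AE)
    have "AE t in lborel. t \<noteq> q" by (rule AE_lborel_singleton)
    then show "AE t in lborel. emeasure M {\<omega> \<in> space M. Z \<omega> > t \<and> 0 > q - t} =
        ennreal (indicator {q..K} t *\<^sub>R survival M Z t)"
    proof eventually_elim
      case (elim t)
      have "{\<omega> \<in> space M. Z \<omega> > t \<and> 0 > q - t} = {}" if "t > K \<or> t < q"
        using that Z(2) by (fastforce simp: abs_le_iff)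
      moreover have "{\<omega> \<in> space M. Z \<omega> > t \<and> 0 > q - t} = {\<omega> \<in> space M. Z \<omega> > t}" if "t > q"
        using that by auto
      ultimately show ?case using elim
        by (cases "q < t \<and> t \<le> K")
          (auto simp: survival_def emeasure_eq_measure not_less not_le simp del: Collect_empty_eq)
    qed
  qed
  also have "\<dots> = ennreal (LBINT t:{q..K}. survival M Z t)"
    unfolding set_lebesgue_integral_def
  proof (rule nn_integral_eq_integral)
    have "set_integrable lborel {q..K} (survival M Z)"
      by (rule set_integrable_bounded_Icc[where B = 1]) (auto simp: survival_def)
    then show "integrable lborel (\<lambda>t. indicat_real {q..K} t *\<^sub>R survival M Z t)"
      by (simp add: set_integrable_def)
  qed (auto simp: survival_def)
  finally have "ennreal (expectation (\<lambda>\<omega>. max 0 (Z \<omega> - q))) = ennreal (LBINT t:{q..K}. survival M Z t)" .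
  then show ?thesis
    by (subst (asm) ennreal_inj) (auto simp: set_lebesgue_integral_def survival_def intro!: Bochner_Integration.integral_nonneg)
qed

text \<open>Inclusion-exclusion. For fixed marginals the joint survival function differs from the
  joint distribution function by a term depending on the marginals only, so the two are ordered in
  the same way.\<close>

lemma prob_both_greater:
  fixes X Y :: "'a \<Rightarrow> real"
  assumes [measurable]: "X \<in> borel_measurable M" "Y \<in> borel_measurable M"
  shows "prob {\<omega> \<in> space M. X \<omega> > x \<and> Y \<omega> > y} =
    1 - prob {\<omega> \<in> space M. X \<omega> \<le> x} - prob {\<omega> \<in> space M. Y \<omega> \<le> y}
      + prob {\<omega> \<in> space M. X \<omega> \<le> x \<and> Y \<omega> \<le> y}"
proof -
  let ?A = "{\<omega> \<in> space M. X \<omega> \<le> x}" and ?B = "{\<omega> \<in> space M. Y \<omega> \<le> y}"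
  have "{\<omega> \<in> space M. X \<omega> > x \<and> Y \<omega> > y} = space M - (?A \<union> ?B)" by (auto simp: not_le)
  then have "prob {\<omega> \<in> space M. X \<omega> > x \<and> Y \<omega> > y} = 1 - prob (?A \<union> ?B)"
    by (simp add: prob_compl)
  also have "prob (?A \<union> ?B) = prob ?A + prob ?B - prob (?A \<inter> ?B)"
    by (rule measure_Un3) (auto simp: fmeasurable_eq_sets)
  also have "?A \<inter> ?B = {\<omega> \<in> space M. X \<omega> \<le> x \<and> Y \<omega> \<le> y}" by auto
  finally show ?thesis by simp
qed

text \<open>Both sides integrate a joint survival function along the line of points with coordinate
  sum \<open>q\<close>; equal marginals and ordered joint distribution functions order the
  integrands pointwise.\<close>

lemma expectation_excess_sum_mono:
  fixes X Y X' Y' :: "'a \<Rightarrow> real"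
  assumes X: "X \<in> borel_measurable M" "Y \<in> borel_measurable M"
    and X': "X' \<in> borel_measurable M" "Y' \<in> borel_measurable M"
    and bd: "\<And>\<omega>. \<omega> \<in> space M \<Longrightarrow> \<bar>X \<omega> + Y \<omega>\<bar> \<le> K" "\<And>\<omega>. \<omega> \<in> space M \<Longrightarrow> \<bar>X' \<omega> + Y' \<omega>\<bar> \<le> K"
    and marg: "\<And>x. prob {\<omega> \<in> space M. X' \<omega> \<le> x} = prob {\<omega> \<in> space M. X \<omega> \<le> x}"
      "\<And>y. prob {\<omega> \<in> space M. Y' \<omega> \<le> y} = prob {\<omega> \<in> space M. Y \<omega> \<le> y}"
    and joint: "\<And>x y. prob {\<omega> \<in> space M. X \<omega> \<le> x \<and> Y \<omega> \<le> y} \<le> prob {\<omega> \<in> space M. X' \<omega> \<le> x \<and> Y' \<omega> \<le> y}"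
  shows "expectation (\<lambda>\<omega>. max 0 (X \<omega> + Y \<omega> - q)) \<le> expectation (\<lambda>\<omega>. max 0 (X' \<omega> + Y' \<omega> - q))"
proof -
  note [measurable] = X X'
  have int: "integrable M (\<lambda>\<omega>. max 0 (Z \<omega> - q))"
    if "Z \<in> borel_measurable M" "\<And>\<omega>. \<omega> \<in> space M \<Longrightarrow> \<bar>Z \<omega>\<bar> \<le> K" for Z :: "'a \<Rightarrow> real"
    by (rule integrable_bounded[where K = "K + \<bar>q\<bar>"]) (use that in \<open>force simp: max_def abs_le_iff\<close>)+
  have "(\<integral>\<^sup>+\<omega>. ennreal (max 0 (X \<omega> + Y \<omega> - q)) \<partial>M) \<le> (\<integral>\<^sup>+\<omega>. ennreal (max 0 (X' \<omega> + Y' \<omega> - q)) \<partial>M)"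
    unfolding nn_integral_excess_sum[OF X] nn_integral_excess_sum[OF X']
    by (intro nn_integral_mono)
      (use marg joint in \<open>simp add: ennreal_leI emeasure_eq_measure prob_both_greater[OF X] prob_both_greater[OF X']\<close>)
  also have "(\<integral>\<^sup>+\<omega>. ennreal (max 0 (X \<omega> + Y \<omega> - q)) \<partial>M) = ennreal (expectation (\<lambda>\<omega>. max 0 (X \<omega> + Y \<omega> - q)))"
    using bd by (intro nn_integral_eq_integral int) auto
  also have "(\<integral>\<^sup>+\<omega>. ennreal (max 0 (X' \<omega> + Y' \<omega> - q)) \<partial>M) = ennreal (expectation (\<lambda>\<omega>. max 0 (X' \<omega> + Y' \<omega> - q)))"
    using bd by (intro nn_integral_eq_integral int) auto
  finally show ?thesis by (subst (asm) ennreal_le_iff) (auto intro!: Bochner_Integration.integral_nonneg)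
qed

lemma eq_in_law_prob:
  assumes "eq_in_law M X' X" "X' \<in> borel_measurable M" "X \<in> borel_measurable M" "S \<in> sets borel"
  shows "prob {\<omega> \<in> space M. X' \<omega> \<in> S} = prob {\<omega> \<in> space M. X \<omega> \<in> S}"
proof -
  have "measure (distr M borel X') S = measure (distr M borel X) S"
    using assms by (simp add: eq_in_law_def)
  then show ?thesis
    using assms by (simp add: measure_distr vimage_def Int_def conj_commute)
qed

lemma eq_in_law_expectation:
  fixes X X' :: "'a \<Rightarrow> real"
  assumes "eq_in_law M X' X" "X' \<in> borel_measurable M" "X \<in> borel_measurable M"
  shows "expectation X' = expectation X"
  using assms integral_distr[of X M borel "\<lambda>x. x"] integral_distr[of X' M borel "\<lambda>x. x"]
  by (simp add: eq_in_law_def)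

text \<open>The ordering of the excesses compares the integrals of the survival functions over
  \<open>{q..K}\<close>. Equal marginals give equal expectations of the sums, hence equal integrals
  over \<open>{-K..K}\<close>. Subtracting reverses the comparison on \<open>{-K..q}\<close>, which
  is the form that \<open>convex_integral_mono\<close> takes.\<close>

lemma convex_survival_mono:
  assumes X: "X \<in> bounded_rvs M" "Y \<in> bounded_rvs M"
    and X': "X' \<in> bounded_rvs M" "Y' \<in> bounded_rvs M"
    and law: "eq_in_law M X' X" "eq_in_law M Y' Y"
    and bd: "\<And>\<omega>. \<omega> \<in> space M \<Longrightarrow> \<bar>X \<omega> + Y \<omega>\<bar> \<le> K" "\<And>\<omega>. \<omega> \<in> space M \<Longrightarrow> \<bar>X' \<omega> + Y' \<omega>\<bar> \<le> K"
    and joint: "\<And>x y. prob {\<omega> \<in> space M. X \<omega> \<le> x \<and> Y \<omega> \<le> y} \<le> prob {\<omega> \<in> space M. X' \<omega> \<le> x \<and> Y' \<omega> \<le> y}"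
    and h: "convex_on {0..1} h" "\<And>s. s \<in> {0..1} \<Longrightarrow> \<bar>h s\<bar> \<le> B"
  shows "(LBINT t:{-K..K}. h (survival M (\<lambda>\<omega>. X' \<omega> + Y' \<omega>) t))
      \<le> (LBINT t:{-K..K}. h (survival M (\<lambda>\<omega>. X \<omega> + Y \<omega>) t))"
proof -
  have [measurable]: "X \<in> borel_measurable M" "Y \<in> borel_measurable M"
      "X' \<in> borel_measurable M" "Y' \<in> borel_measurable M"
    using X X' by (auto simp: bounded_rvs_def)
  have i: "integrable M X" "integrable M Y" "integrable M X'" "integrable M Y'"
    using X X' by (auto simp: bounded_rvs_def intro: integrable_bounded)
  let ?Z = "\<lambda>\<omega>. X \<omega> + Y \<omega>" and ?Z' = "\<lambda>\<omega>. X' \<omega> + Y' \<omega>"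
  let ?F = "survival M ?Z" and ?G = "survival M ?Z'"
  have am: "antimono ?F" "antimono ?G" by (intro antimono_survival; measurable)+
  note [measurable] = am[THEN antimono_borel_measurable]
  have tail: "(LBINT t:{q..K}. ?F t) \<le> (LBINT t:{q..K}. ?G t)" for q
  proof (subst (1 2) integral_survival)
    show "expectation (\<lambda>\<omega>. max 0 (?Z \<omega> - q)) \<le> expectation (\<lambda>\<omega>. max 0 (?Z' \<omega> - q))"
      using law by (intro expectation_excess_sum_mono[where K = K] bd joint
          eq_in_law_prob[of _ _ "{.._}", simplified]) auto
  qed (use bd in auto)
  have total: "(LBINT t:{-K..K}. survival M Z t) = expectation Z + K"
    if "integrable M Z" "\<And>\<omega>. \<omega> \<in> space M \<Longrightarrow> \<bar>Z \<omega>\<bar> \<le> K" for Z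
  proof -
    have "(LBINT t:{-K..K}. survival M Z t) = expectation (\<lambda>\<omega>. max 0 (Z \<omega> - (-K)))"
      using that by (intro integral_survival) auto
    also have "\<dots> = expectation (\<lambda>\<omega>. Z \<omega> + K)"
      using that(2) by (intro Bochner_Integration.integral_cong) (force simp: abs_le_iff max_def)+
    finally show ?thesis using that(1) by (simp add: prob_space)
  qed
  have eq: "(LBINT t:{-K..K}. ?G t) = (LBINT t:{-K..K}. ?F t)"
    using law i bd by (simp add: total eq_in_law_expectation)
  have split: "(LBINT t:{-K..K}. survival M Z t) = (LBINT t:{-K..q}. survival M Z t) + (LBINT t:{q..K}. survival M Z t)"
    if q: "q \<in> {-K..K}" and [measurable]: "Z \<in> borel_measurable M" for q Z
  proof -
    note [measurable] = antimono_survival[of Z, THEN antimono_borel_measurable]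
    have s: "set_integrable lborel {a..b} (survival M Z)" for a b
      by (rule set_integrable_bounded_Icc[where B = 1]) (auto simp: survival_def)
    have "(LBINT t:{-K..K}. survival M Z t) = (LBINT t:{-K..q} \<union> {q..K}. survival M Z t)"
      using q by (simp add: ivl_disj_un)
    also have "\<dots> = (LBINT t:{-K..q}. survival M Z t) + (LBINT t:{q..K}. survival M Z t)"
      by (intro set_integral_Un_AE s AE_I'[of "{q}"]) auto
    finally show ?thesis .
  qed
  show ?thesis
  proof (rule convex_integral_mono[OF am(1) survival_mem am(2) survival_mem _ eq h])
    fix q assume "q \<in> {-K..K}"
    then show "(LBINT t:{-K..q}. ?G t) \<le> (LBINT t:{-K..q}. ?F t)"
      using split[of q ?Z] split[of q ?Z'] tail[of q] eq by simp
  qed auto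
qed

text \<open>Beyond the bound \<open>K\<close> both defining integrands vanish, because
  \<open>h 0 = 0\<close> and \<open>h 1 = 1\<close>. The term \<open>- K\<close> is the integral of
  \<open>- 1\<close> over \<open>{-K..0}\<close>. Variables with a common bound can then be compared
  through one integral over the same interval.\<close>

lemma distorted_expectation_eq:
  assumes h: "distortion h" and [measurable]: "Z \<in> borel_measurable M"
    and bd: "\<And>\<omega>. \<omega> \<in> space M \<Longrightarrow> \<bar>Z \<omega>\<bar> \<le> K"
  shows "distorted_expectation M h Z = (LBINT t:{-K..K}. h (survival M Z t)) - K"
proof -
  obtain \<omega> where "\<omega> \<in> space M" using not_empty by blast
  with bd have K: "K \<ge> 0" by force
  have hr: "h s \<in> {0..1}" if "s \<in> {0..1}" for s using h that by (auto simp: distortion_def)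
  have "antimono (\<lambda>t. h (survival M Z t))"
    using h antimono_survival[of Z] survival_mem[of Z]
    by (intro antimonoI mono_onD[of "{0..1}" h]) (auto simp: distortion_def antimono_def)
  note [measurable] = antimono_borel_measurable[OF this]
  have s: "set_integrable lborel {a..b} (\<lambda>t. h (survival M Z t))"
    "set_integrable lborel {a..b} (\<lambda>t. h (survival M Z t) - 1)"
    "set_integrable lborel {a..b} (\<lambda>t. 1::real)" for a b
    using hr[OF survival_mem[of Z]]
    by (auto intro!: set_integrable_bounded_Icc[where B = 1] simp: abs_le_iff)
  have zero: "h (survival M Z t) = 0" if "t \<ge> K" for t
  proof -
    have "{\<omega> \<in> space M. Z \<omega> > t} = {}" using bd that by (force simp: abs_le_iff)
    then show ?thesis using h by (simp only: survival_def distortion_def measure_empty)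
  qed
  \<comment> \<open>The inequality is strict, unlike in \<open>zero\<close>: \<open>Z\<close> may
    take the value \<open>-K\<close> with positive probability, and then the survival function at
    \<open>-K\<close> is below 1.\<close>
  have one: "h (survival M Z t) = 1" if "t < -K" for t
  proof -
    have "{\<omega> \<in> space M. Z \<omega> > t} = space M" using bd that by (force simp: abs_le_iff)
    then show ?thesis using h by (simp add: survival_def distortion_def prob_space)
  qed
  have "(LBINT t:{0..}. h (survival M Z t)) = (LBINT t:{0..K}. h (survival M Z t))"
    unfolding set_lebesgue_integral_def
    by (intro Bochner_Integration.integral_cong) (auto simp: indicator_def zero)
  moreover have "(LBINT t:{..0}. h (survival M Z t) - 1) = (LBINT t:{-K..0}. h (survival M Z t) - 1)"
    unfolding set_lebesgue_integral_def
    by (intro Bochner_Integration.integral_cong) (auto simp: indicator_def one)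
  moreover have "(LBINT t:{-K..0}. h (survival M Z t) - 1) = (LBINT t:{-K..0}. h (survival M Z t)) - (LBINT t:{-K..0}. 1)"
    by (intro set_integral_diff s)
  moreover have "(LBINT t:{-K..0}. 1) = K" using K by (simp add: set_lebesgue_integral_def)
  moreover have "(LBINT t:{-K..0} \<union> {0..K}. h (survival M Z t)) =
      (LBINT t:{-K..0}. h (survival M Z t)) + (LBINT t:{0..K}. h (survival M Z t))"
    by (intro set_integral_Un_AE s AE_I'[of "{0}"]) auto
  moreover have "{-K..0} \<union> {0..K} = {-K..K}" using K by auto
  ultimately show ?thesis
    by (simp add: distorted_expectation_def survival_def[abs_def])
qed

end

section \<open>Copulas\<close>

abbreviation unif :: "real measure" where
  "unif \<equiv> uniform_measure lborel {0..1}"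

lemma prob_space_unif: "prob_space unif"
  by (rule prob_space_uniform_measure) auto

lemma measure_unif: "S \<in> sets borel \<Longrightarrow> measure unif S = measure lborel ({0..1} \<inter> S)"
  by simp

lemma measure_unif_atMost: "measure unif {..u} = max 0 (min 1 u)"
proof -
  have "{0..1} \<inter> {..u} = {0..min 1 u}" by auto
  then show ?thesis by (simp add: measure_unif max_def)
qed

lemma distr_unif_reflect: "distr unif borel (\<lambda>x. 1 - x) = unif"
proof (rule cdf_unique)
  interpret U: prob_space unif by (rule prob_space_unif)
  show "real_distribution (distr unif borel (\<lambda>x. 1 - x))"
    by (rule U.real_distribution_distr) simp
  show "real_distribution unif"
    by unfold_locales simp_all
  show "cdf (distr unif borel (\<lambda>x. 1 - x)) = cdf unif"
  proof
    fix t
    have "cdf (distr unif borel (\<lambda>x. 1 - x)) t = measure unif ((\<lambda>x. 1 - x) -` {..t} \<inter> space unif)"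
      unfolding cdf_def by (rule measure_distr) auto
    also have "(\<lambda>x. 1 - x) -` {..t} \<inter> space unif = {1 - t..}" by auto
    also have "measure unif {1 - t..} = measure lborel {max 0 (1 - t)..1}"
      by (simp add: measure_unif Int_atLeastAtMost)
    also have "\<dots> = max 0 (min 1 t)" by (auto simp: max_def min_def)
    also have "\<dots> = cdf unif t" unfolding cdf_def by (rule measure_unif_atMost[symmetric])
    finally show "cdf (distr unif borel (\<lambda>x. 1 - x)) t = cdf unif t" .
  qed
qed

text \<open>A copula arises as the joint distribution function of two measure-preserving images of
  one uniform variable. The pair \<open>x\<close>, \<open>x\<close> yields \<open>C_plus\<close>,
  and the antithetic pair \<open>x\<close>, \<open>1 - x\<close> yields
  \<open>C_minus\<close>.\<close>

lemma is_copulaI_unif: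
  assumes [measurable]: "f \<in> borel_measurable borel" "g \<in> borel_measurable borel"
    and marg: "distr unif borel f = unif" "distr unif borel g = unif"
    and C: "\<And>u v. u \<in> {0..1} \<Longrightarrow> v \<in> {0..1} \<Longrightarrow> C u v = measure unif {x. f x \<le> u \<and> g x \<le> v}"
  shows "is_copula C"
  unfolding is_copula_def
proof (intro exI conjI ballI)
  interpret U: prob_space unif by (rule prob_space_unif)
  let ?\<mu> = "distr unif borel (\<lambda>x. (f x, g x))"
  have m: "(\<lambda>x. (f x, g x)) \<in> unif \<rightarrow>\<^sub>M borel" by simp
  show "prob_space ?\<mu>" by (rule U.prob_space_distr[OF m])
  show "sets ?\<mu> = sets borel" by simp
  have "distr ?\<mu> borel fst = distr unif borel (fst \<circ> (\<lambda>x. (f x, g x)))"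
    by (rule distr_distr[OF _ m]) (simp add: borel_prod[symmetric])
  then show "distr ?\<mu> borel fst = unif" using marg by (simp add: o_def)
  have "distr ?\<mu> borel snd = distr unif borel (snd \<circ> (\<lambda>x. (f x, g x)))"
    by (rule distr_distr[OF _ m]) (simp add: borel_prod[symmetric])
  then show "distr ?\<mu> borel snd = unif" using marg by (simp add: o_def)
  fix u v :: real assume uv: "u \<in> {0..1}" "v \<in> {0..1}"
  have "measure ?\<mu> ({..u} \<times> {..v}) = measure unif ((\<lambda>x. (f x, g x)) -` ({..u} \<times> {..v}) \<inter> space unif)"
    by (rule measure_distr[OF m]) (auto intro!: borel_closed closed_Times)
  also have "(\<lambda>x. (f x, g x)) -` ({..u} \<times> {..v}) \<inter> space unif = {x. f x \<le> u \<and> g x \<le> v}" by auto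
  finally show "C u v = measure ?\<mu> ({..u} \<times> {..v})" using C[OF uv] by simp
qed

lemma is_copula_C_plus: "is_copula C_plus"
proof (rule is_copulaI_unif[of "\<lambda>x. x" "\<lambda>x. x"])
  have "distr unif borel (\<lambda>x. x) = distr unif unif (\<lambda>x. x)" by (intro distr_cong) auto
  then show "distr unif borel (\<lambda>x. x) = unif" "distr unif borel (\<lambda>x. x) = unif" by simp_all
  fix u v :: real assume "u \<in> {0..1}" "v \<in> {0..1}"
  moreover have "{x. x \<le> u \<and> x \<le> v} = {..min u v}" by auto
  ultimately show "C_plus u v = measure unif {x. x \<le> u \<and> x \<le> v}"
    by (auto simp: measure_unif_atMost C_plus_def simp del: measure_uniform_measure)
qed auto

lemma is_copula_C_minus: "is_copula C_minus"
proof (rule is_copulaI_unif[of "\<lambda>x. x" "\<lambda>x. 1 - x"])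
  have "distr unif borel (\<lambda>x. x) = distr unif unif (\<lambda>x. x)" by (intro distr_cong) auto
  then show "distr unif borel (\<lambda>x. x) = unif" by simp
  fix u v :: real assume uv: "u \<in> {0..1}" "v \<in> {0..1}"
  \<comment> \<open>The interval is empty when \<open>u + v < 1\<close>; this is where the maximum
    with 0 in \<open>C_minus\<close> comes from.\<close>
  then have "{0..1} \<inter> {x. x \<le> u \<and> 1 - x \<le> v} = {1 - v..u}" by auto
  then have "measure unif {x. x \<le> u \<and> 1 - x \<le> v} = measure lborel {1 - v..u}"
    by (subst measure_unif) auto
  then show "C_minus u v = measure unif {x. x \<le> u \<and> 1 - x \<le> v}"
    by (simp add: C_minus_def max_def)
qed (auto simp: distr_unif_reflect)

text \<open>Under the representing measure \<open>C u v\<close> is the probability of the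
  intersection of two events of probabilities \<open>u\<close> and \<open>v\<close>. Their union has
  probability at most 1, which gives the lower bound; monotonicity gives the upper one.\<close>

lemma copula_Frechet_bounds:
  assumes C: "is_copula C" and u: "u \<in> {0..1}" and v: "v \<in> {0..1}"
  shows "max (u + v - 1) 0 \<le> C u v" "C u v \<le> min u v"
proof -
  obtain \<mu> :: "(real \<times> real) measure" where "prob_space \<mu>" and sets: "sets \<mu> = sets borel"
    and marg: "distr \<mu> borel fst = unif" "distr \<mu> borel snd = unif"
    and eq: "C u v = measure \<mu> ({..u} \<times> {..v})"
    using C u v by (auto simp: is_copula_def)
  interpret prob_space \<mu> by fact
  have sp: "space \<mu> = UNIV" using sets_eq_imp_space_eq[OF sets] by simp
  have m: "fst \<in> borel_measurable \<mu>" "snd \<in> borel_measurable \<mu>"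
    by (simp_all add: measurable_cong_sets[OF sets refl] borel_prod[symmetric])
  let ?A = "fst -` {..u} \<inter> space \<mu>" and ?B = "snd -` {..v} \<inter> space \<mu>"
  have ev: "?A \<in> events" "?B \<in> events" using m by (auto intro: measurable_sets)
  have pA: "prob ?A = u"
    using measure_distr[OF m(1), of "{..u}"] u unfolding marg measure_unif_atMost by simp
  have pB: "prob ?B = v"
    using measure_distr[OF m(2), of "{..v}"] v unfolding marg measure_unif_atMost by simp
  have "{..u} \<times> {..v} = ?A \<inter> ?B" by (auto simp: sp)
  then have pAB: "C u v = prob (?A \<inter> ?B)" using eq by simp
  have "prob (?A \<union> ?B) = prob ?A + prob ?B - prob (?A \<inter> ?B)"
    using ev by (intro measure_Un3) (auto simp: fmeasurable_eq_sets)
  moreover have "prob (?A \<union> ?B) \<le> 1" by simp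
  ultimately show "max (u + v - 1) 0 \<le> C u v" using pA pB pAB by simp
  show "C u v \<le> min u v"
    using finite_measure_mono[of "?A \<inter> ?B" ?A] finite_measure_mono[of "?A \<inter> ?B" ?B] ev pA pB pAB by auto
qed

section \<open>Strict convexity\<close>

lemma strictly_convex_on_imp_convex_on:
  "strictly_convex_on S f \<Longrightarrow> convex_on S f"
proof (rule convex_onI)
  fix t x y :: real
  assume *: "strictly_convex_on S f" and t: "0 < t" "t < 1" "x \<in> S" "y \<in> S"
  show "f ((1 - t) *\<^sub>R x + t *\<^sub>R y) \<le> (1 - t) * f x + t * f y"
  proof (cases "x = y")
    case True
    then show ?thesis by (simp flip: scaleR_add_left distrib_right)
  next
    case False
    then have "f ((1 - t) * x + t * y) < (1 - t) * f x + t * f y"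
      using * t by (simp add: strictly_convex_on_def)
    then show ?thesis by simp
  qed
qed (simp add: strictly_convex_on_def)

text \<open>The inner points are convex combinations of the outer ones with weights \<open>t\<close>
  and \<open>1 - t\<close> interchanged, as the sums agree. Adding the two strict inequalities makes
  the weights add up to 1 at each outer point.\<close>

lemma strictly_convex_on_spread:
  assumes f: "strictly_convex_on S f" and S: "a \<in> S" "b \<in> S"
    and lt: "b < a'" "a' < a" and sum: "a + b = a' + b'"
  shows "f a' + f b' < f a + f b"
proof -
  define t where "t = (a' - b) / (a - b)"
  have t: "0 < t" "t < 1" using lt by (auto simp: t_def)
  have "t * (a - b) = a' - b" using lt by (simp add: t_def)
  then have e: "(1 - t) * b + t * a = a'" "(1 - (1 - t)) * b + (1 - t) * a = b'"
    using sum by (auto simp: algebra_simps)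
  have strict: "f ((1 - s) * b + s * a) < (1 - s) * f b + s * f a" if "0 < s" "s < 1" for s
    using f S lt that by (simp add: strictly_convex_on_def)
  from strict[of t] strict[of "1 - t"] have "f a' < (1 - t) * f b + t * f a" "f b' < (1 - (1 - t)) * f b + (1 - t) * f a"
    using t unfolding e by simp_all
  then show ?thesis by (simp add: algebra_simps)
qed

section \<open>Optimality and uniqueness\<close>

context prob_space begin

section \<open>Two-valued test variables\<close>

lemma prob_indicator_compl_le:
  assumes A: "A \<in> events"
  shows "prob {\<omega> \<in> space M. indicat_real (space M - A) \<omega> \<le> x} =
    (if x < 0 then 0 else if x < 1 then prob A else 1)"
proof -
  have "{\<omega> \<in> space M. indicat_real (space M - A) \<omega> \<le> x} =
      (if x < 0 then {} else if x < 1 then A else space M)"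
    using sets.sets_into_space[OF A] by (auto simp: indicator_def split: if_splits)
  then show ?thesis by (simp add: prob_space)
qed

lemma eq_in_lawI:
  assumes [measurable]: "X \<in> borel_measurable M" "Y \<in> borel_measurable M"
    and "\<And>x. prob {\<omega> \<in> space M. X \<omega> \<le> x} = prob {\<omega> \<in> space M. Y \<omega> \<le> x}"
  shows "eq_in_law M X Y"
  unfolding eq_in_law_def
proof (rule cdf_unique)
  show "cdf (distr M borel X) = cdf (distr M borel Y)"
  proof
    fix x
    have "cdf (distr M borel Z) x = prob {\<omega> \<in> space M. Z \<omega> \<le> x}"
      if [measurable]: "Z \<in> borel_measurable M" for Z :: "'a \<Rightarrow> real"
      by (simp add: cdf_def measure_distr vimage_def Int_def conj_commute)
    with assms show "cdf (distr M borel X) x = cdf (distr M borel Y) x" by simp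
  qed
qed (auto intro: real_distribution_distr)

lemma indicator_compl_bounded_rvs:
  "A \<in> events \<Longrightarrow> indicat_real (space M - A) \<in> bounded_rvs M"
  by (auto simp: bounded_rvs_def indicator_def intro!: exI[of _ 1])

text \<open>The marginal distribution functions take only the values 0, 1 and \<open>prob A\<close>
  or \<open>prob B\<close>. Where one argument is 0 or 1 the Frechet bounds coincide and determine
  \<open>D\<close>, so the single value at \<open>(prob A, prob B)\<close> remains to be
  matched.\<close>

lemma copula_of_indicators:
  assumes D: "is_copula D" and A: "A \<in> events" and B: "B \<in> events"
    and eq: "D (prob A) (prob B) = prob (A \<inter> B)"
  shows "copula_of M D (indicat_real (space M - A)) (indicat_real (space M - B))"
  unfolding copula_of_def
proof (intro allI)
  fix x y :: real
  have "D 0 v = 0" "D v 0 = 0" "D 1 v = v" "D v 1 = v" if "v \<in> {0..1}" for v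
    using copula_Frechet_bounds[OF D, of 0 v] copula_Frechet_bounds[OF D, of v 0]
      copula_Frechet_bounds[OF D, of 1 v] copula_Frechet_bounds[OF D, of v 1] that by auto
  moreover have "{\<omega> \<in> space M. indicat_real (space M - A) \<omega> \<le> x \<and> indicat_real (space M - B) \<omega> \<le> y} =
      (if x < 0 \<or> y < 0 then {} else if x < 1 then (if y < 1 then A \<inter> B else A)
       else if y < 1 then B else space M)"
    using sets.sets_into_space[OF A] sets.sets_into_space[OF B]
    by (auto simp: indicator_def split: if_splits)
  ultimately show "prob {\<omega> \<in> space M. indicat_real (space M - A) \<omega> \<le> x \<and> indicat_real (space M - B) \<omega> \<le> y} =
      D (prob {\<omega> \<in> space M. indicat_real (space M - A) \<omega> \<le> x})
        (prob {\<omega> \<in> space M. indicat_real (space M - B) \<omega> \<le> y})"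
    using eq by (simp add: prob_indicator_compl_le A B prob_space)
qed

text \<open>The sum takes the values 0, 1 and 2, so its survival function is constant on unit steps,
  with the probability of missing \<open>A\<close> or \<open>B\<close> on the first and of missing
  both on the second. With \<open>K = 2\<close> the contribution 2 of the negative half cancels the
  term \<open>- K\<close>.\<close>

lemma distorted_expectation_indicators:
  assumes h: "distortion h" and A: "A \<in> events" and B: "B \<in> events"
  shows "distorted_expectation M h (\<lambda>\<omega>. indicat_real (space M - A) \<omega> + indicat_real (space M - B) \<omega>) =
    h (1 - prob (A \<inter> B)) + h (1 - prob A - prob B + prob (A \<inter> B))"
proof -
  let ?Z = "\<lambda>\<omega>. indicat_real (space M - A) \<omega> + indicat_real (space M - B) \<omega>"
  let ?a = "1 - prob (A \<inter> B)" and ?b = "1 - prob A - prob B + prob (A \<inter> B)"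
  have "prob (A \<union> B) = prob A + prob B - prob (A \<inter> B)"
    using A B by (intro measure_Un3) (auto simp: fmeasurable_eq_sets)
  then have p: "prob (space M - A \<inter> B) = ?a" "prob (space M - (A \<union> B)) = ?b"
    using A B by (simp_all add: prob_compl)
  have "survival M ?Z t = (if t < 0 then 1 else if t < 1 then ?a else if t < 2 then ?b else 0)" for t
  proof -
    have "{\<omega> \<in> space M. ?Z \<omega> > t} = (if t < 0 then space M else if t < 1 then space M - A \<inter> B
        else if t < 2 then space M - (A \<union> B) else {})"
      by (auto simp: indicator_def split: if_splits)
    then show ?thesis using p by (simp add: survival_def prob_space)
  qed
  \<comment> \<open>Half-open intervals match the strict inequality in \<open>survival\<close>. At
    the right end \<open>t = 2\<close> the integrand is \<open>h 0 = 0\<close>.\<close>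
  then have "indicat_real {-2..2} t *\<^sub>R h (survival M ?Z t) =
      indicat_real {-2..<0::real} t + h ?a * indicat_real {0..<1::real} t + h ?b * indicat_real {1..<2::real} t" for t
    using h by (auto simp: indicator_def distortion_def)
  then have "(LBINT t:{-2..2}. h (survival M ?Z t)) =
      (LBINT t. indicat_real {-2..<0::real} t + h ?a * indicat_real {0..<1::real} t + h ?b * indicat_real {1..<2::real} t)"
    unfolding set_lebesgue_integral_def by simp
  also have "\<dots> = 2 + h ?a + h ?b"
  proof -
    have i: "integrable lborel (indicat_real {c..<d})" for c d :: real
      by (rule integrable_real_indicator) (cases "c \<le> d"; simp)+
    show ?thesis by (simp add: i)
  qed
  finally show ?thesis
    using A B by (subst distorted_expectation_eq[OF h, where K = 2]) (auto simp: indicator_def)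
qed

text \<open>Both \<open>D u v\<close> and \<open>w\<close> lie between the Frechet bounds, so both
  occur as intersection probabilities of events with probabilities \<open>u\<close> and
  \<open>v\<close>. The first pair of indicators has copula \<open>D\<close>; the second has the
  same marginals and is an admissible competitor.\<close>

lemma universally_optimal_imp_le:
  assumes at: "atomless M" and h: "distortion h" and D: "is_copula D" "universally_optimal M h D"
    and u: "u \<in> {0..1}" and v: "v \<in> {0..1}" and w: "max (u + v - 1) 0 \<le> w" "w \<le> min u v"
  shows "h (1 - D u v) + h (1 - u - v + D u v) \<le> h (1 - w) + h (1 - u - v + w)"
proof -
  obtain A B where A: "A \<in> events" "B \<in> events" "prob A = u" "prob B = v" "prob (A \<inter> B) = D u v"
    using atomless_events_with_intersection[OF at u v copula_Frechet_bounds[OF D(1) u v]] .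
  obtain A' B' where A': "A' \<in> events" "B' \<in> events" "prob A' = u" "prob B' = v" "prob (A' \<inter> B') = w"
    using atomless_events_with_intersection[OF at u v w] .
  have "eq_in_law M (indicat_real (space M - A')) (indicat_real (space M - A))"
    "eq_in_law M (indicat_real (space M - B')) (indicat_real (space M - B))"
    using A A' by (auto intro!: eq_in_lawI simp: prob_indicator_compl_le)
  then have "distorted_expectation M h (\<lambda>\<omega>. indicat_real (space M - A) \<omega> + indicat_real (space M - B) \<omega>)
      \<le> distorted_expectation M h (\<lambda>\<omega>. indicat_real (space M - A') \<omega> + indicat_real (space M - B') \<omega>)"
    using D(2)[unfolded universally_optimal_def, rule_format,
        OF A(1,2)[THEN indicator_compl_bounded_rvs] copula_of_indicators[OF D(1) A(1,2)]
          A'(1,2)[THEN indicator_compl_bounded_rvs]] A by simp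
  then show ?thesis using A A' by (simp add: distorted_expectation_indicators[OF h])
qed

section \<open>Optimality of the Frechet bounds\<close>

lemma bounded_sum_bound:
  assumes "X \<in> bounded_rvs M" "Y \<in> bounded_rvs M" "X' \<in> bounded_rvs M" "Y' \<in> bounded_rvs M"
  obtains K where "\<And>\<omega>. \<omega> \<in> space M \<Longrightarrow> \<bar>X \<omega> + Y \<omega>\<bar> \<le> K" "\<And>\<omega>. \<omega> \<in> space M \<Longrightarrow> \<bar>X' \<omega> + Y' \<omega>\<bar> \<le> K"
proof -
  obtain a b a' b' where "\<And>\<omega>. \<omega> \<in> space M \<Longrightarrow> \<bar>X \<omega>\<bar> \<le> a" "\<And>\<omega>. \<omega> \<in> space M \<Longrightarrow> \<bar>Y \<omega>\<bar> \<le> b"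
    "\<And>\<omega>. \<omega> \<in> space M \<Longrightarrow> \<bar>X' \<omega>\<bar> \<le> a'" "\<And>\<omega>. \<omega> \<in> space M \<Longrightarrow> \<bar>Y' \<omega>\<bar> \<le> b'"
    using assms unfolding bounded_rvs_def by blast
  then show ?thesis using that[of "max (a + b) (a' + b')"]
    by (smt (verit) max.cobounded1 max.cobounded2)
qed

text \<open>Stated for random variables rather than copulas, so that it applies to competitors
  without first producing a copula for them. For the lower bound, the part
  \<open>p x + q y - 1\<close> comes from the nonnegativity of the joint survival function.\<close>

lemma joint_prob_Frechet_bounds:
  fixes X Y :: "'a \<Rightarrow> real"
  assumes [measurable]: "X \<in> borel_measurable M" "Y \<in> borel_measurable M"
  defines "p \<equiv> \<lambda>x. prob {\<omega> \<in> space M. X \<omega> \<le> x}" and "q \<equiv> \<lambda>y. prob {\<omega> \<in> space M. Y \<omega> \<le> y}"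
  shows "C_minus (p x) (q y) \<le> prob {\<omega> \<in> space M. X \<omega> \<le> x \<and> Y \<omega> \<le> y}"
    "prob {\<omega> \<in> space M. X \<omega> \<le> x \<and> Y \<omega> \<le> y} \<le> C_plus (p x) (q y)"
proof -
  show "C_minus (p x) (q y) \<le> prob {\<omega> \<in> space M. X \<omega> \<le> x \<and> Y \<omega> \<le> y}"
    using measure_nonneg[of M "{\<omega> \<in> space M. X \<omega> > x \<and> Y \<omega> > y}"]
    unfolding prob_both_greater[OF assms(1,2)] by (simp add: C_minus_def p_def q_def)
  show "prob {\<omega> \<in> space M. X \<omega> \<le> x \<and> Y \<omega> \<le> y} \<le> C_plus (p x) (q y)"
    unfolding C_plus_def p_def q_def by (intro min.boundedI finite_measure_mono) auto
qed

lemma distortion_abs_le: "distortion h \<Longrightarrow> s \<in> {0..1} \<Longrightarrow> \<bar>h s\<bar> \<le> 1"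
  using funcset_mem[of h "{0..1}" "{0..1}" s] by (simp add: distortion_def)

text \<open>A pair with copula \<open>C_plus\<close> has the largest joint distribution function for
  its marginals, so its sum is largest in convex order. Hence \<open>convex_survival_mono\<close> is
  used with the competitor as its first pair.\<close>

lemma universally_optimal_C_plus:
  assumes h: "distortion h" "convex_on {0..1} h"
  shows "universally_optimal M h C_plus"
  unfolding universally_optimal_def
proof (intro ballI impI)
  fix X Y X' Y'
  assume rv: "X \<in> bounded_rvs M" "Y \<in> bounded_rvs M" "X' \<in> bounded_rvs M" "Y' \<in> bounded_rvs M"
    and C: "copula_of M C_plus X Y" and law: "eq_in_law M X' X" "eq_in_law M Y' Y"
  have [measurable]: "X \<in> borel_measurable M" "Y \<in> borel_measurable M"
      "X' \<in> borel_measurable M" "Y' \<in> borel_measurable M"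
    using rv by (auto simp: bounded_rvs_def)
  obtain K where K: "\<And>\<omega>. \<omega> \<in> space M \<Longrightarrow> \<bar>X \<omega> + Y \<omega>\<bar> \<le> K" "\<And>\<omega>. \<omega> \<in> space M \<Longrightarrow> \<bar>X' \<omega> + Y' \<omega>\<bar> \<le> K"
    using bounded_sum_bound[OF rv] by blast
  have "(LBINT t:{-K..K}. h (survival M (\<lambda>\<omega>. X \<omega> + Y \<omega>) t))
      \<le> (LBINT t:{-K..K}. h (survival M (\<lambda>\<omega>. X' \<omega> + Y' \<omega>) t))"
  proof (rule convex_survival_mono[where B = 1])
    show "prob {\<omega> \<in> space M. X' \<omega> \<le> x \<and> Y' \<omega> \<le> y} \<le> prob {\<omega> \<in> space M. X \<omega> \<le> x \<and> Y \<omega> \<le> y}" for x y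
      using joint_prob_Frechet_bounds(2)[of X' Y' x y] C eq_in_law_prob[OF law(1), of "{..x}"]
        eq_in_law_prob[OF law(2), of "{..y}"]
      by (simp add: copula_of_def)
  qed (use rv K law h distortion_abs_le in \<open>auto simp: eq_in_law_def\<close>)
  then show "distorted_expectation M h (\<lambda>\<omega>. X \<omega> + Y \<omega>) \<le> distorted_expectation M h (\<lambda>\<omega>. X' \<omega> + Y' \<omega>)"
    using K by (simp add: distorted_expectation_eq[OF h(1), where K = K])
qed

text \<open>Here the joint distribution function is the smallest one, so \<open>X + Y\<close>
  maximises the integral of the convex function \<open>- h\<close> of the survival function, and
  thus minimises that of \<open>h\<close>.\<close>

lemma universally_optimal_C_minus:
  assumes h: "distortion h" "convex_on {0..1} (\<lambda>x. - h x)"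
  shows "universally_optimal M h C_minus"
  unfolding universally_optimal_def
proof (intro ballI impI)
  fix X Y X' Y'
  assume rv: "X \<in> bounded_rvs M" "Y \<in> bounded_rvs M" "X' \<in> bounded_rvs M" "Y' \<in> bounded_rvs M"
    and C: "copula_of M C_minus X Y" and law: "eq_in_law M X' X" "eq_in_law M Y' Y"
  have [measurable]: "X \<in> borel_measurable M" "Y \<in> borel_measurable M"
      "X' \<in> borel_measurable M" "Y' \<in> borel_measurable M"
    using rv by (auto simp: bounded_rvs_def)
  obtain K where K: "\<And>\<omega>. \<omega> \<in> space M \<Longrightarrow> \<bar>X \<omega> + Y \<omega>\<bar> \<le> K" "\<And>\<omega>. \<omega> \<in> space M \<Longrightarrow> \<bar>X' \<omega> + Y' \<omega>\<bar> \<le> K"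
    using bounded_sum_bound[OF rv] by blast
  have "(LBINT t:{-K..K}. - h (survival M (\<lambda>\<omega>. X' \<omega> + Y' \<omega>) t))
      \<le> (LBINT t:{-K..K}. - h (survival M (\<lambda>\<omega>. X \<omega> + Y \<omega>) t))"
  proof (rule convex_survival_mono[where B = 1 and h = "\<lambda>x. - h x"])
    show "prob {\<omega> \<in> space M. X \<omega> \<le> x \<and> Y \<omega> \<le> y} \<le> prob {\<omega> \<in> space M. X' \<omega> \<le> x \<and> Y' \<omega> \<le> y}" for x y
      using joint_prob_Frechet_bounds(1)[of X' Y' x y] C eq_in_law_prob[OF law(1), of "{..x}"]
        eq_in_law_prob[OF law(2), of "{..y}"]
      by (simp add: copula_of_def)
  qed (use rv K law h distortion_abs_le in auto)
  then show "distorted_expectation M h (\<lambda>\<omega>. X \<omega> + Y \<omega>) \<le> distorted_expectation M h (\<lambda>\<omega>. X' \<omega> + Y' \<omega>)"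
    using K by (simp add: distorted_expectation_eq[OF h(1), where K = K] set_lebesgue_integral_def)
qed

end

theorem theorem3:
  fixes M :: "'a measure" and h :: "real \<Rightarrow> real"
  assumes "prob_space M" and "atomless M" and "distortion h"
  shows "(strictly_convex_on {0..1} h \<longrightarrow> unique_universally_optimal_copula M h C_plus) \<and>
         (strictly_concave_on {0..1} h \<longrightarrow> unique_universally_optimal_copula M h C_minus)"
proof -
  interpret prob_space M by fact
  show ?thesis
    unfolding unique_universally_optimal_copula_def
  proof (intro conjI impI allI ballI)
    assume cx: "strictly_convex_on {0..1} h"
    show "is_copula C_plus" by (rule is_copula_C_plus)
    show "universally_optimal M h C_plus"
      using assms(3) strictly_convex_on_imp_convex_on[OF cx] by (rule universally_optimal_C_plus)
    fix D u v assume D: "is_copula D" "universally_optimal M h D" and uv: "u \<in> {0..1::real}" "v \<in> {0..1::real}"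
    show "D u v = C_plus u v"
    proof (rule ccontr)
      note bounds = copula_Frechet_bounds[OF D(1) uv]
      assume "D u v \<noteq> C_plus u v"
      then have "D u v < min u v" using bounds unfolding C_plus_def by linarith
      \<comment> \<open>The arguments add up to \<open>2 - u - v\<close> on both sides, and the
        smaller value \<open>D u v\<close> puts them further apart. Comparing with the admissible
        value \<open>w = min u v\<close> then contradicts optimality.\<close>
      then have "h (1 - min u v) + h (1 - u - v + min u v) < h (1 - D u v) + h (1 - u - v + D u v)"
        using bounds uv by (intro strictly_convex_on_spread[OF cx]) (auto simp: min_def split: if_splits)
      moreover have "h (1 - D u v) + h (1 - u - v + D u v) \<le> h (1 - min u v) + h (1 - u - v + min u v)"
        using uv by (intro universally_optimal_imp_le assms(2,3) D) auto
      ultimately show False by simp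
    qed
  next
    assume "strictly_concave_on {0..1} h"
    then have cx: "strictly_convex_on {0..1} (\<lambda>x. - h x)" by (simp add: strictly_concave_on_def)
    show "is_copula C_minus" by (rule is_copula_C_minus)
    show "universally_optimal M h C_minus"
      using assms(3) strictly_convex_on_imp_convex_on[OF cx] by (rule universally_optimal_C_minus)
    fix D u v assume D: "is_copula D" "universally_optimal M h D" and uv: "u \<in> {0..1::real}" "v \<in> {0..1::real}"
    show "D u v = C_minus u v"
    proof (rule ccontr)
      note bounds = copula_Frechet_bounds[OF D(1) uv]
      let ?m = "max (u + v - 1) 0"
      assume "D u v \<noteq> C_minus u v"
      then have "?m < D u v" using bounds unfolding C_minus_def by linarith
      \<comment> \<open>For \<open>- h\<close> the roles are reversed: the lower bound
        \<open>?m\<close> gives the outer pair and \<open>D u v\<close> the inner one.\<close>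
      then have "- h (1 - D u v) + - h (1 - u - v + D u v) < - h (1 - ?m) + - h (1 - u - v + ?m)"
        using bounds uv by (intro strictly_convex_on_spread[OF cx]) (auto simp: max_def min_def split: if_splits)
      moreover have "h (1 - D u v) + h (1 - u - v + D u v) \<le> h (1 - ?m) + h (1 - u - v + ?m)"
        using uv by (intro universally_optimal_imp_le assms(2,3) D) auto
      ultimately show False by simp
    qed
  qed
qed

end
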